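(* Let $m\ge d$ and let $(M,A)$ be a closed PL manifold of dimension $m$ with a free simplicial involution $A$ that is a $\mathrm{BUT}_{m,d}$ manifold. Let $T$ be an equivariant triangulation of $M$ and let $L:V(T)\to\{+1,-1,\ldots,+d,-d\}$ satisfy $L(A(v))=-L(v)$ for all $v$. Then there exists an edge $uv$ of $T$ with $L(u)=-L(v)$.
   Context: A free involution is a map $A:M\to M$ with $A(A(x))=x$, $A(x)\neq x$ for all $x$. A triangulation is equivariant if $A$ maps it simplicially onto itself. $(M,A)$ is $\mathrm{BUT}_{m,d}$ if for every continuous $g:M\to\mathbb{R}^d$ there is $x\in M$ with $g(A(x))=g(x)$. *)

theory Defs
  imports "HOL-Analysis.Analysis"
begin

text \<open>
  A polyhedron is given locally by the finite geometric simplicial complexes of the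
  library. The map \<open>f\<close> is piecewise linear on \<open>X\<close> if each point of \<open>X\<close> has a neighbourhood
  in \<open>X\<close> that is triangulated by such a complex with \<open>f\<close> affine on every simplex. This covers
  both open subsets of Euclidean space and compact polyhedra; continuity of \<open>f\<close> on \<open>X\<close> is a
  consequence.
\<close>

definition affine_map_on :: "'a::real_vector set \<Rightarrow> ('a \<Rightarrow> 'b::real_vector) \<Rightarrow> bool" where
  "affine_map_on S f \<longleftrightarrow> (\<exists>g c. linear g \<and> (\<forall>x\<in>S. f x = g x + c))"

definition pl_on :: "'a::euclidean_space set \<Rightarrow> ('a \<Rightarrow> 'b::euclidean_space) \<Rightarrow> bool" where
  "pl_on X f \<longleftrightarrow>
     (\<forall>x\<in>X. \<exists>K. simplicial_complex K \<and> \<Union>K \<subseteq> X \<and>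
        x \<in> (top_of_set X) interior_of \<Union>K \<and> (\<forall>S\<in>K. affine_map_on S f))"

text \<open>
  A closed (compact, without boundary) PL manifold of dimension \<open>CARD('m)\<close>: the PL structure
  is a set of charts \<open>(U, \<phi>)\<close>. The atlas need not be maximal, and the manifold need not be
  connected. For the transition maps, exchanging the two charts shows that the inverses are
  piecewise linear as well.
\<close>

definition closed_pl_manifold ::
  "'a topology \<Rightarrow> ('a set \<times> ('a \<Rightarrow> real^'m)) set \<Rightarrow> bool" where
  "closed_pl_manifold M \<Phi> \<longleftrightarrow>
     compact_space M \<and> Hausdorff_space M \<and>
     \<Union>(fst ` \<Phi>) = topspace M \<and>
     (\<forall>(U, \<phi>)\<in>\<Phi>. openin M U \<and> open (\<phi> ` U) \<and>
        homeomorphic_map (subtopology M U) (top_of_set (\<phi> ` U)) \<phi>) \<and>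
     (\<forall>(U, \<phi>)\<in>\<Phi>. \<forall>(V, \<psi>)\<in>\<Phi>. pl_on (\<phi> ` (U \<inter> V)) (\<psi> \<circ> inv_into U \<phi>))"

text \<open>
  A triangulation of \<open>M\<close> is a finite simplicial complex \<open>K\<close> with a PL homeomorphism
  \<open>h\<close> from its underlying polyhedron onto \<open>M\<close>. (A homeomorphism that is piecewise linear
  in one direction is piecewise linear in the other.)
\<close>

definition pl_triangulation ::
  "'a topology \<Rightarrow> ('a set \<times> ('a \<Rightarrow> real^'m)) set \<Rightarrow>
    'b::euclidean_space set set \<Rightarrow> ('b \<Rightarrow> 'a) \<Rightarrow> bool" where
  "pl_triangulation M \<Phi> K h \<longleftrightarrow>
     simplicial_complex K \<and>
     homeomorphic_map (top_of_set (\<Union>K)) M h \<and>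
     (\<forall>(U, \<phi>)\<in>\<Phi>. pl_on {x \<in> \<Union>K. h x \<in> U} (\<phi> \<circ> h))"

definition equivariant_triangulation ::
  "'a topology \<Rightarrow> ('a set \<times> ('a \<Rightarrow> real^'m)) set \<Rightarrow> ('a \<Rightarrow> 'a) \<Rightarrow>
    'b::euclidean_space set set \<Rightarrow> ('b \<Rightarrow> 'a) \<Rightarrow> bool" where
  "equivariant_triangulation M \<Phi> A K h \<longleftrightarrow>
     pl_triangulation M \<Phi> K h \<and>
     (let f = inv_into (\<Union>K) h \<circ> A \<circ> h
      in (\<forall>S\<in>K. affine_map_on S f) \<and> (\<lambda>S. f ` S) ` K = K)"

text \<open>Vertices and edges, transported to \<open>M\<close> by the homeomorphism \<open>h\<close>.\<close>

definition tri_vertices :: "'b::euclidean_space set set \<Rightarrow> ('b \<Rightarrow> 'a) \<Rightarrow> 'a set" where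
  "tri_vertices K h = h ` {x. {x} \<in> K}"

definition tri_edge :: "'b::euclidean_space set set \<Rightarrow> ('b \<Rightarrow> 'a) \<Rightarrow> 'a \<Rightarrow> 'a \<Rightarrow> bool" where
  "tri_edge K h u v \<longleftrightarrow>
     (\<exists>x y. x \<noteq> y \<and> closed_segment x y \<in> K \<and> u = h x \<and> v = h y)"

definition free_involution :: "'a topology \<Rightarrow> ('a \<Rightarrow> 'a) \<Rightarrow> bool" where
  "free_involution M A \<longleftrightarrow>
     (\<forall>x\<in>topspace M. A x \<in> topspace M \<and> A (A x) = x \<and> A x \<noteq> x)"

text \<open>
  The condition that every continuous map to \<open>d\<close>-dimensional Euclidean space
  identifies some pair \<open>x\<close>, \<open>A x\<close>.
\<close>

definition BUT :: "nat \<Rightarrow> 'a topology \<Rightarrow> ('a \<Rightarrow> 'a) \<Rightarrow> bool" where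
  "BUT d M A \<longleftrightarrow>
     (\<forall>g. continuous_map M (Euclidean_space d) g \<longrightarrow> (\<exists>x\<in>topspace M. g (A x) = g x))"

end

theory Submission
  imports Defs
begin

text \<open>
  Extend \<open>v \<mapsto> sgn (L v) \<cdot> e\<^sub>i\<close>, where \<open>i = \<bar>L v\<bar>\<close>, from the vertices to a map \<open>M \<rightarrow> \<real>\<^sup>d\<close> that
  is affine on every simplex. It is continuous and anticommutes with \<open>A\<close>, so the Borsuk--Ulam
  property gives it a zero. At a zero in a simplex \<open>S\<close>, some vertex of \<open>S\<close> has positive barycentric
  coordinate; its contribution must be cancelled by a vertex of \<open>S\<close> with the opposite label.
\<close>

lemma affine_map_on_sum:
  assumes "affine_map_on S f" "convex S" "finite C" "C \<subseteq> S"
    and "\<And>v. v \<in> C \<Longrightarrow> 0 \<le> u v" "sum u C = 1"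
  shows "f (\<Sum>v\<in>C. u v *\<^sub>R v) = (\<Sum>v\<in>C. u v *\<^sub>R f v)"
proof -
  obtain g c where g: "linear g" "\<And>x. x \<in> S \<Longrightarrow> f x = g x + c"
    using assms(1) unfolding affine_map_on_def by blast
  have "(\<Sum>v\<in>C. u v *\<^sub>R v) \<in> S"
    using assms by (intro convex_sum) auto
  then have "f (\<Sum>v\<in>C. u v *\<^sub>R v) = (\<Sum>v\<in>C. u v *\<^sub>R g v) + c"
    using g by (simp add: linear_sum linear_cmul)
  also have "\<dots> = (\<Sum>v\<in>C. u v *\<^sub>R (g v + c))"
    using assms(6) by (simp add: algebra_simps sum.distrib flip: scaleR_left.sum)
  also have "\<dots> = (\<Sum>v\<in>C. u v *\<^sub>R f v)"
    using g assms(4) by (intro sum.cong) auto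
  finally show ?thesis .
qed

lemma affine_map_on_continuous:
  fixes f :: "'a::euclidean_space \<Rightarrow> 'b::real_normed_vector"
  assumes "affine_map_on S f"
  shows "continuous_on S f"
proof -
  obtain g c where g: "linear g" "\<And>x. x \<in> S \<Longrightarrow> f x = g x + c"
    using assms unfolding affine_map_on_def by blast
  have "continuous_on S (\<lambda>x. g x + c)"
    using g(1) by (intro continuous_intros linear_continuous_on linear_conv_bounded_linear[THEN iffD1])
  then show ?thesis
    using g(2) by (simp cong: continuous_on_cong)
qed

text \<open>Moving one point \<open>a\<close> of \<open>C\<close> to the origin turns affine
  independence into linear independence of the differences, where a linear map can be prescribed
  freely; the added constant then corrects the value at \<open>a\<close>.\<close>

lemma affine_map_exists:
  fixes C :: "'a::euclidean_space set" and val :: "'a \<Rightarrow> 'b::real_vector"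
  assumes "\<not> affine_dependent C"
  shows "\<exists>F. affine_map_on UNIV F \<and> (\<forall>v\<in>C. F v = val v)"
proof (cases "C = {}")
  case True
  have "affine_map_on UNIV (\<lambda>x::'a. 0::'b)"
    unfolding affine_map_on_def by (intro exI[of _ "\<lambda>x. 0"]) (auto simp: linear_zero)
  with True show ?thesis by blast
next
  case False
  then obtain a where a: "a \<in> C" by blast
  have "independent ((\<lambda>x. - a + x) ` (C - {a}))"
    using assms affine_dependent_iff_dependent2[OF a] by blast
  from linear_independent_extend[OF this, of "\<lambda>y. val (a + y) - val a"]
  obtain g where g: "linear g"
    "\<And>x. x \<in> C - {a} \<Longrightarrow> g (- a + x) = val x - val a"
    by auto
  have "val v = g v + (val a - g a)" if "v \<in> C" for v
    using g(2)[of v] that linear_diff[OF g(1), of v a]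
    by (cases "v = a") (auto simp: algebra_simps)
  moreover have "affine_map_on UNIV (\<lambda>x. g x + (val a - g a))"
    unfolding affine_map_on_def using g(1) by blast
  ultimately show ?thesis
    by (intro exI[of _ "\<lambda>x. g x + (val a - g a)"]) simp
qed

text \<open>The singletons of \<open>K\<close> inside \<open>S\<close> are exactly the extreme
  points of \<open>S\<close>, because \<open>K\<close> is closed under faces and two of its
  simplices meet in a face. Vertices are thus described by \<open>K\<close> alone, so those of a
  common face are the shared vertices.\<close>

lemma simplex_vertices:
  assumes "simplicial_complex K" "S \<in> K"
  shows "\<not> affine_dependent {v\<in>S. {v} \<in> K}" "S = convex hull {v\<in>S. {v} \<in> K}"
proof -
  obtain C where C: "\<not> affine_dependent C" "S = convex hull C"
    using assms unfolding simplicial_complex_def simplex_def by blast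
  have "v \<in> C \<longleftrightarrow> v \<in> S \<and> {v} \<in> K" for v
  proof
    assume "v \<in> C"
    then have "{v} face_of S"
      using C by (simp add: face_of_singleton extreme_point_of_convex_hull_affine_independent)
    then show "v \<in> S \<and> {v} \<in> K"
      using assms face_of_imp_subset unfolding simplicial_complex_def by blast
  next
    assume v: "v \<in> S \<and> {v} \<in> K"
    then have "(S \<inter> {v}) face_of S"
      using assms unfolding simplicial_complex_def by blast
    with v have "{v} face_of S" by (simp add: Int_absorb1)
    then show "v \<in> C"
      using C by (simp add: face_of_singleton extreme_point_of_convex_hull_affine_independent)
  qed
  then have "{v\<in>S. {v} \<in> K} = C" by blast
  then show "\<not> affine_dependent {v\<in>S. {v} \<in> K}" "S = convex hull {v\<in>S. {v} \<in> K}"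
    using C by metis+
qed

lemma simplex_barycentric:
  assumes "simplicial_complex K" "S \<in> K" "x \<in> S"
  shows "\<exists>u. (\<forall>v\<in>{v\<in>S. {v} \<in> K}. 0 \<le> u v) \<and> sum u {v\<in>S. {v} \<in> K} = 1 \<and>
    (\<Sum>v\<in>{v\<in>S. {v} \<in> K}. u v *\<^sub>R v) = x"
proof -
  note vert = simplex_vertices[OF assms(1,2)]
  have "x \<in> convex hull {v\<in>S. {v} \<in> K}"
    using assms(3) vert(2) by metis
  then show ?thesis
    unfolding convex_hull_finite[OF aff_independent_finite[OF vert(1)]] by (rule CollectD)
qed

text \<open>Affine maps chosen separately on each simplex glue: they agree on overlaps, and
  \<open>K\<close> is a finite family of closed sets.\<close>

lemma simplicial_complex_extension:
  fixes K :: "'a::euclidean_space set set" and val :: "'a \<Rightarrow> 'b::real_normed_vector"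
  assumes K: "simplicial_complex K"
  obtains G where "continuous_on (\<Union>K) G" "\<And>S. S \<in> K \<Longrightarrow> affine_map_on S G"
    "\<And>v. {v} \<in> K \<Longrightarrow> G v = val v"
proof -
  have "\<forall>S\<in>K. \<exists>F. affine_map_on UNIV F \<and> (\<forall>v\<in>{v\<in>S. {v} \<in> K}. F v = val v)"
    using affine_map_exists[OF simplex_vertices(1)[OF K]] by (rule ballI)
  from bchoice[OF this] obtain F where
    "\<forall>S\<in>K. affine_map_on UNIV (F S) \<and> (\<forall>v\<in>{v\<in>S. {v} \<in> K}. F S v = val v)" ..
  then have F: "\<And>S. S \<in> K \<Longrightarrow> affine_map_on UNIV (F S)"
      "\<And>S v. S \<in> K \<Longrightarrow> v \<in> S \<Longrightarrow> {v} \<in> K \<Longrightarrow> F S v = val v"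
    by simp_all
  \<comment> \<open>The common face \<open>S \<inter> T\<close> is itself a simplex of
    \<open>K\<close>, so \<open>x\<close> is a convex combination of shared vertices, where both
    maps take the values \<open>val\<close>.\<close>
  have agree: "F S x = F T x" if ST: "S \<in> K" "T \<in> K" "x \<in> S" "x \<in> T" for S T x
  proof -
    let ?R = "S \<inter> T" and ?C = "{v\<in>S \<inter> T. {v} \<in> K}"
    have R: "?R \<in> K"
      using K ST unfolding simplicial_complex_def by blast
    obtain u where u: "\<forall>v\<in>?C. 0 \<le> u v" "sum u ?C = 1" "(\<Sum>v\<in>?C. u v *\<^sub>R v) = x"
      using simplex_barycentric[OF K R IntI[OF ST(3,4)]] by (elim exE conjE)
    have "finite ?C"
      using simplex_vertices(1)[OF K R] by (rule aff_independent_finite)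
    then have eq: "F U x = (\<Sum>v\<in>?C. u v *\<^sub>R F U v)" if "U \<in> K" for U
      using affine_map_on_sum[OF F(1)[OF that] convex_UNIV _ subset_UNIV _ u(2)] u(1)
      unfolding u(3) by blast
    show ?thesis
      unfolding eq[OF ST(1)] eq[OF ST(2)] using F(2) ST by (intro sum.cong) auto
  qed
  define G where "G x = F (SOME S. S \<in> K \<and> x \<in> S) x" for x
  have G: "G x = F S x" if "S \<in> K" "x \<in> S" for S x
  proof -
    have "(SOME S. S \<in> K \<and> x \<in> S) \<in> K \<and> x \<in> (SOME S. S \<in> K \<and> x \<in> S)"
      by (rule someI[of _ S]) (use that in simp)
    then show ?thesis
      unfolding G_def by (intro agree) (use that in simp_all)
  qed
  have aff: "affine_map_on S G" if "S \<in> K" for S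
    using F(1)[OF that] G[OF that] unfolding affine_map_on_def by auto
  have "continuous_on (\<Union>S\<in>K. S) G"
    using K unfolding simplicial_complex_def
    by (intro continuous_on_closed_Union affine_map_on_continuous aff)
      (auto intro: closed_simplex)
  moreover have "G v = val v" if "{v} \<in> K" for v
    using G[OF that singletonI] F(2)[OF that singletonI that] by (rule trans)
  ultimately show thesis
    by (intro that[of G] aff) simp_all
qed

theorem theorem6p2:
  fixes M :: "'a topology" and A :: "'a \<Rightarrow> 'a"
    and \<Phi> :: "('a set \<times> ('a \<Rightarrow> real^'m)) set"
    and K\<^sub>0 :: "'c::euclidean_space set set" and h\<^sub>0 :: "'c \<Rightarrow> 'a"
    and K :: "'b::euclidean_space set set" and h :: "'b \<Rightarrow> 'a"
    and L :: "'a \<Rightarrow> int" and d :: nat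
  assumes "CARD('m) \<ge> d"
    and "closed_pl_manifold M \<Phi>"
    and "free_involution M A"
    and A_simplicial: "equivariant_triangulation M \<Phi> A K\<^sub>0 h\<^sub>0"
    and "BUT d M A"
    and "equivariant_triangulation M \<Phi> A K h"
    and "\<forall>v\<in>tri_vertices K h. L v \<in> {1..int d} \<union> {- int d..-1}"
    and "\<forall>v\<in>tri_vertices K h. L (A v) = - L v"
  shows "\<exists>u v. tri_edge K h u v \<and> L u = - L v"
proof -
  \<comment> \<open>The involution pulled back to the polyhedron, where it is affine on simplices
    and permutes them.\<close>
  define f where "f = inv_into (\<Union>K) h \<circ> A \<circ> h"
  have K: "simplicial_complex K" and hom: "homeomorphic_map (top_of_set (\<Union>K)) M h"
    and f_aff: "\<And>S. S \<in> K \<Longrightarrow> affine_map_on S f" and f_im: "(\<lambda>S. f ` S) ` K = K"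
    using assms(6) unfolding equivariant_triangulation_def pl_triangulation_def f_def Let_def
    by blast+
  have im: "h ` \<Union>K = topspace M"
    using homeomorphic_imp_surjective_map[OF hom] by auto
  have A: "A y \<in> topspace M" if "y \<in> topspace M" for y
    using assms(3) that unfolding free_involution_def by blast
  have hf: "h (f p) = A (h p)" if "p \<in> \<Union>K" for p
    unfolding f_def comp_def using A im that by (intro f_inv_into_f) blast
  have fS: "f ` S \<in> K" if "S \<in> K" for S
    using f_im that by blast
  have f_vert: "{f v} \<in> K" if "{v} \<in> K" for v
    using fS[OF that] by simp
  have L: "L (h v) \<in> {1..int d} \<union> {- int d..-1}" "L (h (f v)) = - L (h v)" if "{v} \<in> K" for v
  proof -
    have "h v \<in> tri_vertices K h" "h (f v) = A (h v)"
      using that hf[of v] unfolding tri_vertices_def by blast+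
    with assms(7,8) show "L (h v) \<in> {1..int d} \<union> {- int d..-1}" "L (h (f v)) = - L (h v)"
      by auto
  qed

  \<comment> \<open>Coordinates are indexed by \<open>{0..<d}\<close>, so that the label \<open>\<plusminus>(i + 1)\<close> belongs to coordinate \<open>i\<close>.\<close>
  define val :: "nat \<Rightarrow> 'b \<Rightarrow> real" where
    "val i v = (if L (h v) = int i + 1 then 1 else if L (h v) = - (int i + 1) then -1 else 0)" for i v
  have val_f: "val i (f v) = - val i v" if "{v} \<in> K" for i v
    using L[OF that] unfolding val_def by auto
  have "\<exists>G. continuous_on (\<Union>K) G \<and> (\<forall>S\<in>K. affine_map_on S G) \<and> (\<forall>v. {v} \<in> K \<longrightarrow> G v = val i v)" for i
    using simplicial_complex_extension[OF K, of "val i"] by metis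
  then obtain G where G_cont: "\<And>i. continuous_on (\<Union>K) (G i)"
    and G_aff: "\<And>i S. S \<in> K \<Longrightarrow> affine_map_on S (G i)"
    and G_val: "\<And>i v. {v} \<in> K \<Longrightarrow> G i v = val i v"
    by metis

  obtain k where k: "homeomorphic_maps (top_of_set (\<Union>K)) M h k"
    using hom homeomorphic_map_maps by blast
  have k_cont: "continuous_map M (top_of_set (\<Union>K)) k"
    and kh: "\<And>p. p \<in> \<Union>K \<Longrightarrow> k (h p) = p"
    using k unfolding homeomorphic_maps_def by auto
  \<comment> \<open>Points of \<open>Euclidean_space d\<close> are real sequences vanishing from
    index \<open>d\<close> on, hence the padding by 0. The inverse \<open>k\<close> of
    \<open>h\<close> carries each \<open>G i\<close> over to \<open>M\<close>.\<close>
  define g where "g y = (\<lambda>i. if i < d then G i (k y) else 0)" for y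
  have "continuous_map M euclideanreal (\<lambda>y. g y i)" for i
  proof (cases "i < d")
    case True
    have "continuous_map (top_of_set (\<Union>K)) euclideanreal (G i)"
      using G_cont by simp
    from continuous_map_compose[OF k_cont this] True show ?thesis
      by (simp add: g_def comp_def)
  qed (simp add: g_def)
  then have "continuous_map M (Euclidean_space d) g"
    unfolding Euclidean_space_def
    by (auto simp: continuous_map_in_subtopology continuous_map_componentwise_UNIV g_def)
  then obtain y where y: "y \<in> topspace M" "g (A y) = g y"
    using assms(5) unfolding BUT_def by blast
  obtain p where p: "p \<in> \<Union>K" "y = h p"
    using im y(1) by blast
  then obtain S where S: "S \<in> K" "p \<in> S" by blast
  have "f p \<in> \<Union>K"
    using fS[OF S(1)] S(2) by blast
  then have k_y: "k (A y) = f p" "k y = p"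
    using p kh hf by metis+
  \<comment> \<open>The Borsuk-Ulam coincidence, read on the polyhedron. Together with the oddness
    of \<open>G i\<close> under \<open>f\<close> shown below, it makes the first \<open>d\<close>
    coordinates vanish at \<open>p\<close>.\<close>
  have fp: "G i (f p) = G i p" if "i < d" for i
    using fun_cong[OF y(2), of i] that by (simp add: g_def k_y)

  let ?C = "{v\<in>S. {v} \<in> K}"
  note vert = simplex_vertices[OF K S(1)]
  have fin: "finite ?C"
    using vert(1) by (rule aff_independent_finite)
  have conv: "convex T" if "T \<in> K" for T
    using simplex_vertices(2)[OF K that] convex_convex_hull by metis
  obtain u where u: "\<forall>v\<in>?C. 0 \<le> u v" "sum u ?C = 1" "(\<Sum>v\<in>?C. u v *\<^sub>R v) = p"
    using simplex_barycentric[OF K S] by (elim exE conjE)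
  have Gp: "G i p = (\<Sum>v\<in>?C. u v * val i v)" for i
    using affine_map_on_sum[OF G_aff[OF S(1)] conv[OF S(1)] fin _ bspec[OF u(1)] u(2), of i]
    by (simp add: G_val u(3))
  have "G i (f p) = - G i p" for i
  proof -
    \<comment> \<open>Since \<open>f\<close> sends \<open>S\<close> affinely onto a simplex of
      \<open>K\<close>, on which \<open>G i\<close> is affine, the composite respects the
      barycentric coordinates of \<open>p\<close>; oddness then only has to be checked at
      vertices.\<close>
    have "affine_map_on S (G i \<circ> f)"
    proof -
      obtain g1 c1 where 1: "linear g1" "\<forall>x\<in>S. f x = g1 x + c1"
        using f_aff[OF S(1)] unfolding affine_map_on_def by blast
      obtain g2 c2 where 2: "linear g2" "\<forall>x\<in>f ` S. G i x = g2 x + c2"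
        using G_aff[OF fS[OF S(1)]] unfolding affine_map_on_def by blast
      have "\<forall>x\<in>S. (G i \<circ> f) x = (g2 \<circ> g1) x + (g2 c1 + c2)"
        using 1 2 by (simp add: linear_add)
      then show ?thesis
        unfolding affine_map_on_def using linear_compose[OF 1(1) 2(1)] by blast
    qed
    from affine_map_on_sum[OF this conv[OF S(1)] fin _ bspec[OF u(1)] u(2)]
    have "G i (f p) = (\<Sum>v\<in>?C. u v * G i (f v))"
      by (simp add: u(3))
    also have "\<dots> = (\<Sum>v\<in>?C. - (u v * val i v))"
      by (intro sum.cong) (auto simp: G_val f_vert val_f)
    finally show ?thesis
      by (simp add: Gp sum_negf)
  qed
  with fp have zero: "(\<Sum>v\<in>?C. u v * val i v) = 0" if "i < d" for i
    using that Gp[of i] by (metis neg_equal_zero)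

  \<comment> \<open>The weights are nonnegative with sum 1, so they cannot all vanish.\<close>
  obtain v where v: "v \<in> ?C" "u v > 0"
    using u(1,2) by (metis (no_types, lifting) less_eq_real_def sum.neutral zero_neq_one)
  \<comment> \<open>The coordinate belonging to the label of \<open>v\<close>. Labels start at
    absolute value 1 and coordinates at 0; the range of labels gives \<open>i < d\<close>.\<close>
  define i where "i = nat (\<bar>L (h v)\<bar> - 1)"
  have i: "i < d" "\<bar>L (h v)\<bar> = int i + 1"
    using L(1)[of v] v(1) unfolding i_def by auto
  then have vv: "val i v * val i v = 1"
    by (auto simp: val_def)
  \<comment> \<open>Multiplying the vanishing sum by \<open>val i v\<close> makes the contribution
    of \<open>v\<close> positive whatever its sign, so some other term must be negative.\<close>
  have "\<exists>w\<in>?C. val i v * val i w < 0"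
  proof (rule ccontr)
    assume "\<not> ?thesis"
    then have "0 \<le> u w * (val i v * val i w)" if "w \<in> ?C" for w
      using bspec[OF u(1) that] that by (subst mult_nonneg_nonneg) (auto simp: not_less)
    moreover have "0 < u v * (val i v * val i v)"
      using v(2) vv by simp
    ultimately have "0 < (\<Sum>w\<in>?C. u w * (val i v * val i w))"
      using fin v(1) by (intro sum_pos2[where i = v]) auto
    also have "\<dots> = val i v * (\<Sum>w\<in>?C. u w * val i w)"
      by (simp add: sum_distrib_left mult_ac)
    finally show False
      using zero[OF i(1)] by simp
  qed
  then obtain w where w: "w \<in> ?C" "val i v * val i w < 0" by blast
  \<comment> \<open>A negative product forces the values 1 and -1 in the same coordinate, that is,
    the labels \<open>i + 1\<close> and \<open>-(i + 1)\<close>.\<close>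
  then have opp: "L (h v) = - L (h w)"
    by (auto simp: val_def split: if_splits)
  have "v \<noteq> w"
    using w(2) vv by auto
  \<comment> \<open>Any subset of affinely independent vertices spans a face, so two distinct
    vertices of \<open>S\<close> span an edge of \<open>K\<close>.\<close>
  moreover have "closed_segment v w face_of S"
    using face_of_convex_hull_affine_independent[OF vert(1), of "closed_segment v w"] vert(2) v(1) w(1)
    unfolding segment_convex_hull by (metis (no_types, lifting) empty_subsetI insert_subset)
  then have "closed_segment v w \<in> K"
    using K S(1) unfolding simplicial_complex_def by blast
  ultimately show ?thesis
    using opp unfolding tri_edge_def by blast
qed

end
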